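(* Let $X=(X_t)_{t\ge 0}$ be a real-valued additive process with $X_0=0$ satisfying $\mathbf{E}(e^{-\lambda X_t})<\infty$ for all $t\ge 0$ and all $\lambda\ge 0$. For $t\ge 0$ and $\lambda\ge 0$ put $\Phi(t;\lambda):=-\log \mathbf{E}(e^{-\lambda X_t})$, and for $0\le s\le t<\infty$ and real $\alpha\ge 0$ put $m^{(\alpha)}_{s,t}:=\mathbf{E}\Big(\big(\int_s^t e^{-X_u}\,du\big)^{\alpha}\Big)$. Then for every real $\alpha\ge 1$ and all $0\le s\le t<\infty$ the moment $m^{(\alpha)}_{s,t}$ is finite, and $$m^{(\alpha)}_{s,t}=\alpha\int_s^t m^{(\alpha-1)}_{u,t}\,e^{-\left(\Phi(u;\alpha)-\Phi(u;\alpha-1)\right)}\,du .$$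
   Context: A real-valued additive process is a real-valued stochastic process $X=(X_t)_{t\ge0}$ with $X_0=0$ a.s., with independent increments (not necessarily stationary), with càdlàg sample paths, and continuous in probability. *)

theory Defs
  imports "HOL-Probability.Probability"
begin

definition cadlag :: "(real \<Rightarrow> real) \<Rightarrow> bool" where
  "cadlag f \<longleftrightarrow>
     (\<forall>t\<ge>0. (f \<longlongrightarrow> f t) (at_right t)) \<and> (\<forall>t>0. \<exists>l. (f \<longlongrightarrow> l) (at_left t))"

text \<open>The time set is the half-line of nonnegative reals; values of a process at negative
  times are irrelevant.\<close>

locale additive_process = prob_space M for M :: "'a measure" +
  fixes X :: "real \<Rightarrow> 'a \<Rightarrow> real"
  assumes random_variable_process: "\<And>t. 0 \<le> t \<Longrightarrow> random_variable borel (X t)"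
    and starts_at_zero: "AE \<omega> in M. X 0 \<omega> = 0"
    and independent_increments:
      "\<And>(n::nat) (\<tau>::nat \<Rightarrow> real). 0 \<le> \<tau> 0 \<Longrightarrow> strict_mono_on {..n} \<tau> \<Longrightarrow>
         indep_vars (\<lambda>_. borel) (\<lambda>i \<omega>. X (\<tau> (Suc i)) \<omega> - X (\<tau> i) \<omega>) {..<n}"
    and cadlag_paths: "\<And>\<omega>. \<omega> \<in> space M \<Longrightarrow> cadlag (\<lambda>t. X t \<omega>)"
    and continuous_in_probability:
      "\<And>t \<epsilon>. 0 \<le> t \<Longrightarrow> 0 < \<epsilon> \<Longrightarrow>
         ((\<lambda>u. prob {\<omega> \<in> space M. \<bar>X u \<omega> - X t \<omega>\<bar> > \<epsilon>}) \<longlongrightarrow> 0) (at t within {0..})"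

definition laplace_exponent :: "'a measure \<Rightarrow> (real \<Rightarrow> 'a \<Rightarrow> real) \<Rightarrow> real \<Rightarrow> real \<Rightarrow> real" where
  "laplace_exponent M X t q = - ln (\<integral>\<omega>. exp (- q * X t \<omega>) \<partial>M)"

definition exp_functional :: "(real \<Rightarrow> 'a \<Rightarrow> real) \<Rightarrow> real \<Rightarrow> real \<Rightarrow> 'a \<Rightarrow> real" where
  "exp_functional X s t \<omega> = (LBINT u:{s..t}. exp (- X u \<omega>))"

text \<open>The moment is extended-valued, so that its finiteness is a genuine assertion. The case
  distinction fixes the convention that the power with exponent 0 is 1, including for base 0
  (which occurs when \<open>s = t\<close>); in the library, \<open>0 powr 0 = 0\<close>.\<close>

definition exp_functional_moment ::
    "'a measure \<Rightarrow> (real \<Rightarrow> 'a \<Rightarrow> real) \<Rightarrow> real \<Rightarrow> real \<Rightarrow> real \<Rightarrow> ennreal" where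
  "exp_functional_moment M X \<alpha> s t =
     (\<integral>\<^sup>+\<omega>. ennreal (if \<alpha> = 0 then 1 else exp_functional X s t \<omega> powr \<alpha>) \<partial>M)"

end

theory Submission
  imports Defs
begin

text \<open>Write \<open>I(u)\<close> for the integral of \<open>exp (- X v)\<close> over \<open>v\<close> from \<open>u\<close> to \<open>t\<close>. Along each path,
  \<open>I(s)\<close> to the power \<open>\<alpha>\<close> is \<open>\<alpha>\<close> times the integral of \<open>I(u) powr (\<alpha> - 1) * exp (- X u)\<close> over
  \<open>u\<close> from \<open>s\<close> to \<open>t\<close>; take expectations and exchange the integrals. Now
  \<open>I(u) = exp (- X u) * J(u)\<close>, where \<open>J(u)\<close> is a limit of Riemann sums of functions of the
  increments after \<open>u\<close> and hence independent of \<open>X u\<close>. Replacing the exponent \<open>\<alpha> - 1\<close> of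
  \<open>exp (- X u)\<close> by \<open>\<alpha>\<close> therefore only multiplies the moment by the quotient of the two Laplace
  transforms at time \<open>u\<close>. Finiteness follows from Jensen's inequality, because the exponential
  moments are bounded on bounded time intervals.\<close>

section \<open>Cadlag functions: local boundedness and Riemann sums\<close>

text \<open>One-sided limits bound the function on both sides of each point, and Bolzano bisection
  glues these local bounds into a single one.\<close>

lemma cadlag_bounded:
  assumes "cadlag f" and "0 \<le> t"
  shows "\<exists>B. \<forall>x\<in>{0..t}. \<bar>f x\<bar> \<le> B"
proof -
  \<comment> \<open>The guard \<open>0 \<le> x\<close> is there because bisection asks for a bound
    on all small intervals around a point, including those reaching below 0, where nothing is known
    about \<open>f\<close>. It also makes the left-hand bound at the point 0 vacuous.\<close>
  have "\<exists>B. \<forall>x\<in>{0..t}. 0 \<le> x \<longrightarrow> \<bar>f x\<bar> \<le> B"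
    using \<open>0 \<le> t\<close>
  proof (induction rule: Bolzano[where P="\<lambda>a b. \<exists>B. \<forall>x\<in>{a..b}. 0 \<le> x \<longrightarrow> \<bar>f x\<bar> \<le> B"])
    case (trans a b c)
    then obtain B1 B2 where "\<forall>x\<in>{a..b}. 0 \<le> x \<longrightarrow> \<bar>f x\<bar> \<le> B1" "\<forall>x\<in>{b..c}. 0 \<le> x \<longrightarrow> \<bar>f x\<bar> \<le> B2"
      by blast
    then have "\<forall>x\<in>{a..c}. 0 \<le> x \<longrightarrow> \<bar>f x\<bar> \<le> max B1 B2"
      by (auto simp: le_max_iff_disj)
    then show ?case by blast
  next
    case (local x)
    have bounded_near: "\<exists>B. \<forall>\<^sub>F y in F. \<bar>f y\<bar> \<le> B" if "(f \<longlongrightarrow> l) F" for l F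
    proof -
      have "\<forall>\<^sub>F y in F. dist (f y) l < 1"
        using that by (rule tendstoD) simp
      then have "\<forall>\<^sub>F y in F. \<bar>f y\<bar> \<le> \<bar>l\<bar> + 1"
        by eventually_elim (auto simp: dist_real_def)
      then show ?thesis by blast
    qed
    obtain B1 where "\<forall>\<^sub>F y in at_right x. \<bar>f y\<bar> \<le> B1"
      using bounded_near assms(1) local unfolding cadlag_def by meson
    then obtain b where b: "b > x" "\<And>y. x < y \<Longrightarrow> y < b \<Longrightarrow> \<bar>f y\<bar> \<le> B1"
      unfolding eventually_at_right_field by blast
    have "\<exists>B2 c. c < x \<and> (\<forall>y. c < y \<longrightarrow> y < x \<longrightarrow> 0 \<le> y \<longrightarrow> \<bar>f y\<bar> \<le> B2)"
    proof (cases "x = 0")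
      case True
      then show ?thesis by (intro exI[of _ 0] exI[of _ "-1"]) auto
    next
      case False
      then obtain B2 where "\<forall>\<^sub>F y in at_left x. \<bar>f y\<bar> \<le> B2"
        using bounded_near assms(1) local unfolding cadlag_def
        by (metis order_less_le)
      then show ?thesis
        unfolding eventually_at_left_field by blast
    qed
    then obtain B2 c where c: "c < x" "\<And>y. c < y \<Longrightarrow> y < x \<Longrightarrow> 0 \<le> y \<Longrightarrow> \<bar>f y\<bar> \<le> B2"
      by blast
    have bound: "\<bar>f y\<bar> \<le> max (max B1 B2) \<bar>f x\<bar>" if "0 \<le> y" "c < y" "y < b" for y
      using b(2)[of y] c(2)[of y] that by (cases y x rule: linorder_cases) auto
    show ?case
    proof (rule exI[of _ "min (b - x) (x - c)"], intro conjI allI impI)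
      show "0 < min (b - x) (x - c)" using b c by simp
    next
      fix a' b' assume "a' \<le> x \<and> x \<le> b' \<and> b' - a' < min (b - x) (x - c)"
      then show "\<exists>B. \<forall>y\<in>{a'..b'}. 0 \<le> y \<longrightarrow> \<bar>f y\<bar> \<le> B"
        using bound by (intro exI[of _ "max (max B1 B2) \<bar>f x\<bar>"]) auto
    qed
  qed
  then show ?thesis by auto
qed

text \<open>The sum is the integral of a step function whose value at \<open>v\<close> is
  \<open>f\<close> at the right end of the cell of \<open>v\<close>. These ends approach
  \<open>v\<close> from the right, so right-continuity gives pointwise convergence, and the bound
  \<open>B\<close> permits dominated convergence.\<close>

lemma right_continuous_imp_riemann_sums:
  fixes f :: "real \<Rightarrow> real"
  assumes "u < t" and f [measurable]: "f \<in> borel_measurable borel"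
    and bound: "\<And>v. v \<in> {u..t} \<Longrightarrow> \<bar>f v\<bar> \<le> B"
    and right: "\<And>v. v \<in> {u..<t} \<Longrightarrow> (f \<longlongrightarrow> f v) (at_right v)"
  shows "(\<lambda>n. \<Sum>i<Suc n. (t - u) / Suc n * f (u + Suc i * ((t - u) / Suc n)))
           \<longlonglongrightarrow> (LBINT v:{u..t}. f v)"
proof -
  define h where "h n = (t - u) / Suc n" for n :: nat
  have h: "h n > 0" for n
    using \<open>u < t\<close> by (simp add: h_def)
  have h_end: "u + Suc n * h n = t" for n
    by (simp add: h_def)
  have h_lim: "h \<longlonglongrightarrow> 0"
    unfolding h_def by real_asymp
  \<comment> \<open>The cells are closed on the left and open on the right, so the right end lies
    strictly beyond every point of its cell.\<close>
  define J where "J n i = {u + real i * h n ..< u + Suc i * h n}" for n i :: nat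
  define g where "g n v = (\<Sum>i<Suc n. indicator (J n i) v * f (u + Suc i * h n))" for n v
  have B: "0 \<le> B" using bound[of u] \<open>u < t\<close> by auto
  have node: "u + Suc i * h n \<in> {u..t}" if "i < Suc n" for i n
  proof -
    have "Suc i * h n \<le> Suc n * h n"
      using that h[of n] by (intro mult_right_mono) auto
    moreover have "0 \<le> Suc i * h n" using h[of n] by (intro mult_nonneg_nonneg) auto
    ultimately show ?thesis using h_end[of n] unfolding atLeastAtMost_iff by linarith
  qed
  \<comment> \<open>The cell of \<open>v\<close> has index
    \<open>\<lfloor>(v - u) / h n\<rfloor>\<close>; this closed form lets its right end be estimated
    directly later.\<close>
  have g_eq: "\<exists>k<Suc n. real k = of_int \<lfloor>(v - u) / h n\<rfloor> \<and> g n v = f (u + Suc k * h n)" if v: "v \<in> {u..<t}" for n v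
  proof -
    define k where "k = nat \<lfloor>(v - u) / h n\<rfloor>"
    have k: "real k = of_int \<lfloor>(v - u) / h n\<rfloor>"
      using v h[of n] unfolding k_def by (subst of_nat_nat) auto
    have iff: "v \<in> J n i \<longleftrightarrow> i = k" for i
    proof -
      have "v \<in> J n i \<longleftrightarrow> real i \<le> (v - u) / h n \<and> (v - u) / h n < real i + 1"
        using h[of n] by (auto simp: J_def field_simps)
      also have "\<dots> \<longleftrightarrow> \<lfloor>(v - u) / h n\<rfloor> = int i"
        by (simp add: floor_eq_iff)
      also have "\<dots> \<longleftrightarrow> i = k"
        using k by linarith
      finally show ?thesis .
    qed
    have "k < Suc n"
    proof -
      have "v - u < Suc n * h n" using v h_end[of n] by auto
      then have "(v - u) / h n < Suc n" using h[of n] by (simp add: field_simps)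
      then show ?thesis using k by linarith
    qed
    moreover from this have "g n v = f (u + Suc k * h n)"
      unfolding g_def indicator_def iff by (simp add: of_bool_def if_distrib[where f="\<lambda>x. x * _"] cong: if_cong)
    ultimately show ?thesis using k by blast
  qed
  have g_outside: "g n v = 0" if "v \<notin> {u..<t}" for n v
  proof -
    have "v \<notin> J n i" if "i < Suc n" for i
    proof
      assume "v \<in> J n i"
      then have "u + real i * h n \<le> v" "v < u + Suc i * h n" by (auto simp: J_def)
      with node[OF that, of ] \<open>v \<notin> {u..<t}\<close> h[of n] show False
        by (auto simp: not_le) (smt (verit) mult_nonneg_nonneg of_nat_0_le_iff)
    qed
    then show ?thesis by (simp add: g_def)
  qed
  have [measurable]: "J n i \<in> sets borel" for n i by (simp add: J_def)
  have [measurable]: "g n \<in> borel_measurable lborel" for n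
    unfolding g_def by measurable
  have conv: "(\<lambda>n. g n v) \<longlonglongrightarrow> f v" if v: "v \<in> {u..<t}" for v
  proof -
    \<comment> \<open>\<open>w n\<close> is the right end of the cell of \<open>v\<close>. The
      squeeze between \<open>v\<close> and \<open>v + h n\<close> gives convergence; the strict
      inequality \<open>v < w n\<close> turns it into convergence along
      \<open>at_right v\<close>.\<close>
    define w where "w n = u + (of_int \<lfloor>(v - u) / h n\<rfloor> + 1) * h n" for n
    have w: "v < w n \<and> w n \<le> v + h n" for n
    proof -
      have "v - u < (of_int \<lfloor>(v - u) / h n\<rfloor> + 1) * h n"
        unfolding pos_divide_less_eq[OF h, symmetric] by linarith
      moreover have "of_int \<lfloor>(v - u) / h n\<rfloor> * h n \<le> v - u"
        unfolding pos_le_divide_eq[OF h, symmetric] by linarith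
      ultimately show ?thesis by (simp add: w_def algebra_simps)
    qed
    have "(\<lambda>n. v + h n) \<longlonglongrightarrow> v"
      using tendsto_add[OF tendsto_const h_lim, of v] by simp
    then have "w \<longlonglongrightarrow> v"
      using w by (intro tendsto_sandwich[OF _ _ tendsto_const, of v w _ "\<lambda>n. v + h n"]) (auto simp: less_imp_le)
    then have "filterlim w (at_right v) sequentially"
      using w by (auto simp: filterlim_at less_imp_neq[THEN not_sym])
    with right[OF v] have "(\<lambda>n. f (w n)) \<longlonglongrightarrow> f v"
      by (rule filterlim_compose)
    moreover have "f (w n) = g n v" for n
      using g_eq[OF v, of n] by (auto simp: w_def add.commute)
    ultimately show ?thesis by simp
  qed
  have "(\<lambda>n. integral\<^sup>L lborel (g n)) \<longlonglongrightarrow> (\<integral>v. indicator {u..t} v *\<^sub>R f v \<partial>lborel)"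
  proof (rule integral_dominated_convergence[where w="\<lambda>v. B * indicator {u..t} v"])
    show "AE v in lborel. (\<lambda>n. g n v) \<longlonglongrightarrow> indicator {u..t} v *\<^sub>R f v"
      \<comment> \<open>The endpoint \<open>t\<close> lies in no cell, so \<open>g n\<close>
        vanishes there while the limit function need not; it is discarded as a null set.\<close>
      using AE_lborel_singleton[of t]
    proof eventually_elim
      case (elim v)
      then show ?case
        using conv[of v] g_outside[of v] by (cases "v \<in> {u..<t}") auto
    qed
    show "AE v in lborel. norm (g n v) \<le> B * indicator {u..t} v" for n
    proof (rule AE_I2)
      fix v
      show "norm (g n v) \<le> B * indicator {u..t} v"
      proof (cases "v \<in> {u..<t}")
        case True
        then obtain k where "k < Suc n" "g n v = f (u + Suc k * h n)"
          using g_eq by blast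
        then show ?thesis using bound[OF node] True by simp
      qed (use g_outside B in auto)
    qed
    show "integrable lborel (\<lambda>v. B * indicator {u..t} v)"
      using \<open>u < t\<close> by (intro integrable_mult_right integrable_real_indicator) auto
  qed auto
  moreover have "integral\<^sup>L lborel (g n) = (\<Sum>i<Suc n. h n * f (u + Suc i * h n))" for n
  proof -
    have "integral\<^sup>L lborel (g n) = (\<Sum>i<Suc n. \<integral>v. indicator (J n i) v * f (u + Suc i * h n) \<partial>lborel)"
      unfolding g_def
      by (intro Bochner_Integration.integral_sum integrable_mult_left integrable_real_indicator)
         (use h[of n] in \<open>auto simp: J_def distrib_right\<close>)
    also have "\<dots> = (\<Sum>i<Suc n. h n * f (u + Suc i * h n))"
      using h[of n] by (intro sum.cong) (auto simp: J_def algebra_simps)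
    finally show ?thesis .
  qed
  ultimately show ?thesis
    by (simp add: h_def set_lebesgue_integral_def)
qed

section \<open>Tail integrals of positive functions and their powers\<close>

lemma set_nn_integral_eq_set_integral:
  fixes f :: "'a \<Rightarrow> real"
  assumes "set_integrable M A f" and "\<And>v. 0 \<le> f v"
  shows "(\<integral>\<^sup>+v\<in>A. ennreal (f v) \<partial>M) = ennreal (LINT v:A|M. f v)"
proof -
  have "(\<integral>\<^sup>+v\<in>A. ennreal (f v) \<partial>M) = (\<integral>\<^sup>+v. ennreal (indicator A v *\<^sub>R f v) \<partial>M)"
    by (intro nn_integral_cong) (auto split: split_indicator)
  also have "\<dots> = ennreal (LINT v:A|M. f v)"
    unfolding set_lebesgue_integral_def
    using assms by (intro nn_integral_eq_integral) (auto simp: set_integrable_def)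
  finally show ?thesis .
qed

lemma set_nn_integral_pos:
  fixes f :: "real \<Rightarrow> real"
  assumes f [measurable]: "f \<in> borel_measurable borel" and "\<And>v. 0 < f v" and "a < b"
  shows "0 < (\<integral>\<^sup>+v\<in>{a..<b}. ennreal (f v) \<partial>lborel)"
proof (rule ccontr)
  assume "\<not> ?thesis"
  then have "AE v in lborel. ennreal (f v) * indicator {a..<b} v = 0"
    by (subst nn_integral_0_iff_AE[symmetric]) (auto simp: not_less)
  then have "AE v in lborel. v \<notin> {a..<b}"
  proof eventually_elim
    case (elim v)
    then show ?case
      using assms(2)[of v] by (auto simp: ennreal_eq_0_iff split: split_indicator_asm)
  qed
  then have "emeasure lborel {a..<b} = 0"
    by (subst (asm) AE_iff_measurable[of "{a..<b}"]) auto
  then show False using \<open>a < b\<close> by simp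
qed

text \<open>The tail integral pushes the measure with density \<open>f\<close> forward to Lebesgue measure, because
  its superlevel sets are initial segments of the interval.\<close>

lemma nn_integral_tail_integral:
  fixes f :: "real \<Rightarrow> real" and g :: "real \<Rightarrow> ennreal"
  assumes f [measurable]: "f \<in> borel_measurable borel" and pos: "\<And>v. 0 < f v"
    and int: "set_integrable lborel {s..t} f" and "s \<le> t"
    and g [measurable]: "g \<in> borel_measurable borel"
  defines "I \<equiv> \<lambda>u. LBINT v:{u..t}. f v"
  shows "(\<integral>\<^sup>+u\<in>{s..t}. (g (I u) * ennreal (f u)) \<partial>lborel) = (\<integral>\<^sup>+x\<in>{0..I s}. g x \<partial>lborel)"
proof -
  have sub_int: "set_integrable lborel A f" if "A \<subseteq> {s..t}" "A \<in> sets borel" for A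
    using set_integrable_subset[OF int _ that(1)] that(2) by simp
  have nn_I: "(\<integral>\<^sup>+v\<in>A. ennreal (f v) \<partial>lborel) = ennreal (LBINT v:A. f v)"
    if "A \<subseteq> {s..t}" "A \<in> sets borel" for A
    using sub_int[OF that] pos by (intro set_nn_integral_eq_set_integral) (auto simp: less_imp_le)
  have split: "I u = (LBINT v:{u..<w}. f v) + I w" if "s \<le> u" "u \<le> w" "w \<le> t" for u w
  proof -
    have "{u..t} = {u..<w} \<union> {w..t}" using that by auto
    then show ?thesis
      unfolding I_def using that by (simp, intro set_integral_Un sub_int) auto
  qed
  have I_nonneg: "0 \<le> I u" for u
    unfolding I_def set_lebesgue_integral_def
    by (intro integral_nonneg_AE AE_I2) (use pos in \<open>auto simp: less_imp_le split: split_indicator\<close>)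
  have I_strict: "I w < I u" if "s \<le> u" "u < w" "w \<le> t" for u w
  proof -
    have "{u..<w} \<subseteq> {s..t}" using that by auto
    then have "0 < ennreal (LBINT v:{u..<w}. f v)"
      using set_nn_integral_pos[OF f pos \<open>u < w\<close>] nn_I[of "{u..<w}"] by simp
    then show ?thesis using split[of u w] that by (simp add: ennreal_less_zero_iff)
  qed
  have I_end: "I t = 0"
    by (simp add: I_def set_lebesgue_integral_def integral_eq_zero_AE AE_mp[OF AE_lborel_singleton[of t]])
  have I_cont: "continuous_on {s..t} I"
  proof -
    have "continuous_on {s..t} (\<lambda>u. integral {u..t} f)"
      using set_borel_integral_eq_integral(1)[OF int]
      by (rule indefinite_integral_continuous_1')
    moreover have "I u = integral {u..t} f" if "u \<in> {s..t}" for u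
      unfolding I_def by (rule set_borel_integral_eq_integral(2)[OF sub_int]) (use that in auto)
    ultimately show ?thesis by (metis (no_types, lifting) continuous_on_cong)
  qed
  \<comment> \<open>Clamping \<open>u\<close> to the interval extends \<open>I\<close> to a monotone
    function on the whole line, which is therefore Borel measurable.\<close>
  have I_mono: "mono (\<lambda>u. - I (max s (min t u)))"
    using I_strict \<open>s \<le> t\<close> by (intro monoI) (smt (verit))
  have [measurable]: "(\<lambda>u. I (max s (min t u))) \<in> borel_measurable borel"
    using borel_measurable_uminus[OF borel_measurable_mono[OF I_mono]] by simp
  define I' where "I' u = I (max s (min t u))" for u
  have I'[measurable]: "I' \<in> borel_measurable borel"
    unfolding I'_def by measurable
  have I'_eq: "I' u = I u" if "u \<in> {s..t}" for u
    using that by (simp add: I'_def)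
  define N where "N = density lborel (\<lambda>u. ennreal (f u) * indicator {s..t} u)"
  have N: "emeasure N A = (\<integral>\<^sup>+v\<in>A \<inter> {s..t}. ennreal (f v) \<partial>lborel)" if "A \<in> sets borel" for A
    unfolding N_def using that
    by (subst emeasure_density) (auto intro!: nn_integral_cong split: split_indicator)
  have [measurable_cong]: "sets N = sets borel" by (simp add: N_def)
  have push: "distr N borel I' = density lborel (indicator {0..I s})"
  \<comment> \<open>It suffices to compare the two measures on open upper rays, where both are
    finite.\<close>
  proof (rule measure_eqI_lessThan)
    fix x :: real
    have S: "emeasure (distr N borel I') {x<..}
        = (\<integral>\<^sup>+v\<in>{u\<in>{s..t}. x < I u}. ennreal (f v) \<partial>lborel)"
    proof -
      have "(I' -` {x<..} \<inter> space N) \<inter> {s..t} = {u\<in>{s..t}. x < I u}"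
        by (auto simp: I'_eq N_def)
      then show ?thesis
        using N[of "I' -` {x<..} \<inter> space N"] measurable_sets[OF I', of "{x<..}"]
        by (simp add: emeasure_distr N_def)
    qed
    have R: "emeasure (density lborel (indicator {0..I s})) {x<..} = emeasure lborel ({0..I s} \<inter> {x<..})"
      by (subst emeasure_density) (auto simp: indicator_inter_arith[symmetric])
    show eq: "emeasure (distr N borel I') {x<..} = emeasure (density lborel (indicator {0..I s})) {x<..}"
    proof -
      \<comment> \<open>A negative level gives the total mass \<open>I s\<close> on both sides, a
        level above \<open>I s\<close> gives mass 0. In between, the intermediate value theorem
        yields \<open>c\<close> with \<open>I c = x\<close>; the superlevel set is then
        \<open>{s..<c}\<close>, of mass \<open>I s - I c\<close>.\<close>
      consider "x < 0" | "0 \<le> x" "x \<le> I s" | "I s < x" by linarith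
      then show ?thesis
      proof cases
        case 1
        then have "{u\<in>{s..t}. x < I u} = {s..t}" "{0..I s} \<inter> {x<..} = {0..I s}"
          using I_nonneg by (auto intro: less_le_trans)
        then show ?thesis using S R nn_I[of "{s..t}"] I_nonneg[of s] by (simp add: I_def)
      next
        case 2
        then obtain c where c: "c \<in> {s..t}" "I c = x"
          using IVT2'[of I t x s] I_cont I_end \<open>s \<le> t\<close> by auto
        have "{u\<in>{s..t}. x < I u} = {s..<c}"
          using c I_strict by (auto simp: not_less[symmetric]) (metis less_asym less_irrefl linorder_neqE_linordered_idom)+
        moreover have "{0..I s} \<inter> {x<..} = {x<..I s}" "{s..<c} \<subseteq> {s..t}" using 2 c by auto
        ultimately show ?thesis using S R nn_I[of "{s..<c}"] split[of s c] c 2 by simp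
      next
        case 3
        have "I u \<le> I s" if "u \<in> {s..t}" for u
          using I_strict[of s u] that by (cases "u = s") auto
        then have "{u\<in>{s..t}. x < I u} = {}" "{0..I s} \<inter> {x<..} = {}"
          using 3 by force+
        then show ?thesis using S R by simp
      qed
    qed
    have "emeasure lborel ({0..I s} \<inter> {x<..}) \<le> emeasure lborel {0..I s}"
      by (rule emeasure_mono) auto
    then show "emeasure (distr N borel I') {x<..} < \<infinity>"
      using I_nonneg[of s] unfolding eq R by (simp add: le_less_trans)
  qed simp_all
  have "(\<integral>\<^sup>+u\<in>{s..t}. (g (I u) * ennreal (f u)) \<partial>lborel) = (\<integral>\<^sup>+u. (ennreal (f u) * indicator {s..t} u) * g (I' u) \<partial>lborel)"
    by (intro nn_integral_cong) (auto simp: I'_eq mult_ac split: split_indicator)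
  also have "\<dots> = (\<integral>\<^sup>+u. g (I' u) \<partial>N)"
    unfolding N_def by (rule nn_integral_density[symmetric]) auto
  also have "\<dots> = (\<integral>\<^sup>+x. g x \<partial>distr N borel I')"
    by (rule nn_integral_distr[symmetric]) auto
  also have "\<dots> = (\<integral>\<^sup>+x\<in>{0..I s}. g x \<partial>lborel)"
    unfolding push by (subst nn_integral_density) (auto simp: mult.commute)
  finally show ?thesis .
qed

text \<open>After the change of variable \<open>x = I(u)\<close> this is the elementary integral of
  \<open>x powr (\<alpha> - 1)\<close> over \<open>{0..c}\<close>. For \<open>\<alpha> = 1\<close>
  the value \<open>0 powr 0 = 0\<close> enters only at the single point
  \<open>x = 0\<close>.\<close>

lemma tail_integral_powr:
  fixes f :: "real \<Rightarrow> real"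
  assumes f: "f \<in> borel_measurable borel" and pos: "\<And>v. 0 < f v"
    and int: "set_integrable lborel {s..t} f" and "s \<le> t" and "1 \<le> \<alpha>"
  shows "ennreal ((LBINT v:{s..t}. f v) powr \<alpha>)
    = ennreal \<alpha> * (\<integral>\<^sup>+u\<in>{s..t}. (ennreal ((LBINT v:{u..t}. f v) powr (\<alpha> - 1)) * ennreal (f u)) \<partial>lborel)"
proof -
  define c where "c = (LBINT v:{s..t}. f v)"
  have "0 \<le> c"
    unfolding c_def set_lebesgue_integral_def
    by (intro integral_nonneg_AE AE_I2) (use pos in \<open>auto simp: less_imp_le split: split_indicator\<close>)
  have "(\<integral>\<^sup>+u\<in>{s..t}. (ennreal ((LBINT v:{u..t}. f v) powr (\<alpha> - 1)) * ennreal (f u)) \<partial>lborel)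
      = (\<integral>\<^sup>+x\<in>{0..c}. ennreal (x powr (\<alpha> - 1)) \<partial>lborel)"
    unfolding c_def
    by (rule nn_integral_tail_integral[OF f pos int \<open>s \<le> t\<close>, of "\<lambda>x. ennreal (x powr (\<alpha> - 1))"]) simp
  also have "\<dots> = ennreal (c powr \<alpha> / \<alpha>)"
    using has_integral_powr_from_0[of "\<alpha> - 1" c] \<open>0 \<le> c\<close> \<open>1 \<le> \<alpha>\<close>
    by (intro nn_integral_has_integral_lebesgue') auto
  finally show ?thesis
    using \<open>1 \<le> \<alpha>\<close> by (simp add: c_def ennreal_mult[symmetric])
qed

section \<open>Jensen's inequality and products of independent variables\<close>

text \<open>This is Jensen's inequality for the uniform distribution on the interval; undoing the
  normalisation on both sides leaves \<open>(t - s) powr \<alpha> / (t - s)\<close>.\<close>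

lemma set_integral_powr_le:
  fixes f :: "real \<Rightarrow> real"
  assumes f [measurable]: "f \<in> borel_measurable borel" and pos: "\<And>v. 0 < f v" and "s < t" "1 \<le> \<alpha>"
    and int: "set_integrable lborel {s..t} f" "set_integrable lborel {s..t} (\<lambda>v. f v powr \<alpha>)"
  shows "(LBINT v:{s..t}. f v) powr \<alpha> \<le> (t - s) powr (\<alpha> - 1) * (LBINT v:{s..t}. f v powr \<alpha>)"
proof -
  define N where "N = density lborel (\<lambda>x. ennreal (indicator {s..t} x / (t - s)))"
  have N_int: "integrable N g" and N_eq: "integral\<^sup>L N g = (LBINT v:{s..t}. g v) / (t - s)"
    if [measurable]: "g \<in> borel_measurable borel" and "set_integrable lborel {s..t} g" for g :: "real \<Rightarrow> real"
  proof -
    have eq: "(\<lambda>x. (indicator {s..t} x / (t - s)) *\<^sub>R g x) = (\<lambda>x. (indicator {s..t} x *\<^sub>R g x) / (t - s))"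
      by auto
    show "integrable N g"
      unfolding N_def using that(2) \<open>s < t\<close>
      by (subst integrable_density) (auto simp only: eq set_integrable_def[symmetric] intro!: AE_I2, auto simp: set_integrable_def)
    show "integral\<^sup>L N g = (LBINT v:{s..t}. g v) / (t - s)"
      unfolding N_def using \<open>s < t\<close>
      by (subst integral_density) (auto intro!: AE_I2 simp: set_lebesgue_integral_def)
  qed
  have "prob_space N"
  proof
    have "emeasure N (space N) = (\<integral>\<^sup>+x. ennreal (1 / (t - s)) * indicator {s..t} x \<partial>lborel)"
      unfolding N_def by (subst emeasure_density) (auto intro!: nn_integral_cong split: split_indicator)
    also have "\<dots> = 1"
      using \<open>s < t\<close> by (subst nn_integral_cmult_indicator) (auto simp: ennreal_mult[symmetric])
    finally show "emeasure N (space N) = 1" .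
  qed
  then interpret N: prob_space N .
  have "N.expectation f powr \<alpha> \<le> N.expectation (\<lambda>v. f v powr \<alpha>)"
  \<comment> \<open>The open half-line suffices as domain of convexity because \<open>f\<close> is
    strictly positive; \<open>a = 0\<close> is its left end.\<close>
  proof (rule N.jensens_inequality[where I="{0<..}" and a=0 and q="\<lambda>x. x powr \<alpha>"])
    show "integrable N f" "integrable N (\<lambda>v. f v powr \<alpha>)"
      by (intro N_int int; measurable)+
    show "AE v in N. f v \<in> {0<..}"
      using pos by simp
    show "convex_on {0<..} (\<lambda>x::real. x powr \<alpha>)"
      by (rule powr_convex[OF \<open>1 \<le> \<alpha>\<close>])
  qed simp
  then have "(LBINT v:{s..t}. f v) powr \<alpha> / (t - s) powr \<alpha> \<le> (LBINT v:{s..t}. f v powr \<alpha>) / (t - s)"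
    using N_eq[OF _ int(1)] N_eq[OF _ int(2)] \<open>s < t\<close> pos
    by (simp add: powr_divide set_lebesgue_integral_def integral_nonneg_AE less_imp_le)
  then have "(LBINT v:{s..t}. f v) powr \<alpha> \<le> (t - s) powr \<alpha> / (t - s) * (LBINT v:{s..t}. f v powr \<alpha>)"
    using \<open>s < t\<close> by (simp add: divide_simps mult_ac)
  also have "(t - s) powr \<alpha> / (t - s) = (t - s) powr (\<alpha> - 1)"
    using \<open>s < t\<close> by (simp add: powr_diff)
  finally show ?thesis .
qed

lemma (in prob_space) nn_integral_indep_mult:
  fixes A B :: "'a \<Rightarrow> real" and f g :: "real \<Rightarrow> ennreal"
  assumes indep: "indep_var borel A borel B"
    and f: "f \<in> borel_measurable borel" and g: "g \<in> borel_measurable borel"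
  shows "(\<integral>\<^sup>+\<omega>. f (A \<omega>) * g (B \<omega>) \<partial>M) = (\<integral>\<^sup>+\<omega>. f (A \<omega>) \<partial>M) * (\<integral>\<^sup>+\<omega>. g (B \<omega>) \<partial>M)"
proof -
  \<comment> \<open>\<open>indep_var\<close> is independence of a family indexed by
    \<open>bool\<close>; the product rule for families expects a constant target space.\<close>
  have "case_bool borel borel = (\<lambda>_. borel :: ennreal measure)"
    by (auto split: bool.split)
  then have "indep_vars (\<lambda>_. borel) (case_bool (f \<circ> A) (g \<circ> B)) UNIV"
    using indep_var_compose[OF indep f g] by (simp add: indep_var_def)
  then show ?thesis
    using indep_vars_nn_integral[of UNIV "case_bool (f \<circ> A) (g \<circ> B)"]
    by (simp add: UNIV_bool mult.commute comp_def)
qed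

section \<open>Measurability and positivity of the process and its exponential functional\<close>

context additive_process
begin

text \<open>Joint measurability comes from right-continuity: the process is the pointwise limit of
  its values at grid times just to the right. Clamping time at 0 makes the map total, since nothing
  is known at negative times.\<close>

lemma measurable_process_pair:
  "(\<lambda>p. X (max 0 (fst p)) (snd p)) \<in> borel_measurable (borel \<Otimes>\<^sub>M M)"
proof (rule borel_measurable_LIMSEQ_real)
  \<comment> \<open>Adding 1 to the floor gives a grid time strictly to the right of
    \<open>max 0 v\<close>, at distance at most \<open>1 / Suc n\<close>.\<close>
  define r where "r n v = (of_int \<lfloor>real (Suc n) * max 0 v\<rfloor> + 1) / real (Suc n)" for n :: nat and v :: real
  have r: "max 0 v < r n v \<and> r n v \<le> max 0 v + 1 / Suc n" for n v
  proof -
    have "real (Suc n) * max 0 v < of_int \<lfloor>real (Suc n) * max 0 v\<rfloor> + 1"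
      "of_int \<lfloor>real (Suc n) * max 0 v\<rfloor> + 1 \<le> real (Suc n) * max 0 v + 1"
      by linarith+
    then show ?thesis
      unfolding r_def by (simp add: divide_simps mult_ac distrib_left del: of_nat_Suc)
  qed
  show "(\<lambda>n. X (r n (fst p)) (snd p)) \<longlonglongrightarrow> X (max 0 (fst p)) (snd p)"
    if "p \<in> space (borel \<Otimes>\<^sub>M M)" for p
  proof -
    have \<omega>: "snd p \<in> space M"
      using that by (auto simp: space_pair_measure)
    let ?v = "max 0 (fst p)"
    have "(\<lambda>n. ?v + 1 / Suc n) \<longlonglongrightarrow> ?v"
      using tendsto_add[OF tendsto_const[of ?v] LIMSEQ_inverse_real_of_nat]
      by (simp add: inverse_eq_divide)
    then have "(\<lambda>n. r n (fst p)) \<longlonglongrightarrow> ?v"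
      by (rule tendsto_sandwich[OF always_eventually always_eventually tendsto_const, rotated 2])
         (use r in \<open>blast intro: less_imp_le\<close>)+
    then have "filterlim (\<lambda>n. r n (fst p)) (at_right ?v) sequentially"
      unfolding filterlim_at greaterThan_iff
      by (intro conjI always_eventually allI) (use r less_imp_neq[THEN not_sym] in blast)+
    moreover have "((\<lambda>t. X t (snd p)) \<longlongrightarrow> X ?v (snd p)) (at_right ?v)"
      using cadlag_paths[OF \<omega>] by (simp add: cadlag_def)
    ultimately show ?thesis by (rule filterlim_compose[rotated])
  qed
  show "(\<lambda>p. X (r n (fst p)) (snd p)) \<in> borel_measurable (borel \<Otimes>\<^sub>M M)" for n
  proof -
    \<comment> \<open>The floor takes countably many values, so the map is a countable choice among
      random variables. The outer \<open>max 0\<close> makes every index admissible, negative ones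
      too, and is removed afterwards because \<open>r n v\<close> is positive.\<close>
    have "(\<lambda>p. X (max 0 ((of_int \<lfloor>real (Suc n) * max 0 (fst p)\<rfloor> + 1) / real (Suc n))) (snd p))
        \<in> borel_measurable (borel \<Otimes>\<^sub>M M)"
    proof (rule measurable_compose_countable[where f="\<lambda>i p. X (max 0 ((of_int i + 1) / real (Suc n))) (snd p)"])
      show "(\<lambda>p. X (max 0 ((of_int i + 1) / real (Suc n))) (snd p)) \<in> borel_measurable (borel \<Otimes>\<^sub>M M)" for i
        by (rule measurable_compose[OF measurable_snd random_variable_process]) simp
    qed measurable
    then show ?thesis
      using r[of _ n] unfolding r_def[symmetric] by (simp add: max_absorb2 less_imp_le)
  qed
qed

lemma measurable_process_compose [measurable (raw)]:
  assumes "f \<in> borel_measurable N" "g \<in> measurable N M"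
  shows "(\<lambda>x. X (max 0 (f x)) (g x)) \<in> borel_measurable N"
  using measurable_compose[OF measurable_Pair[OF assms] measurable_process_pair] by simp

lemma path_bounded:
  assumes "\<omega> \<in> space M"
  obtains B where "\<And>v. 0 \<le> v \<Longrightarrow> v \<le> t \<Longrightarrow> \<bar>X v \<omega>\<bar> \<le> B"
proof (cases "0 \<le> t")
  case True
  then show ?thesis
    using cadlag_bounded[OF cadlag_paths[OF assms]] that by (meson atLeastAtMost_iff)
qed (use that[of 0] in auto)

lemma measurable_path:
  assumes "\<omega> \<in> space M"
  shows "(\<lambda>v. X (max 0 v) \<omega>) \<in> borel_measurable borel"
  using assms by measurable

lemma set_integrable_exp_path:
  assumes "\<omega> \<in> space M" "0 \<le> s"
  shows "set_integrable lborel {s..t} (\<lambda>v. exp (c * X (max 0 v) \<omega>))"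
proof -
  obtain B where B: "\<And>v. 0 \<le> v \<Longrightarrow> v \<le> t \<Longrightarrow> \<bar>X v \<omega>\<bar> \<le> B"
    using path_bounded[OF assms(1), where t=t] by blast
  have [measurable]: "(\<lambda>v. X (max 0 v) \<omega>) \<in> borel_measurable borel"
    by (rule measurable_path[OF assms(1)])
  have "\<bar>exp (c * X (max 0 v) \<omega>)\<bar> \<le> exp (\<bar>c\<bar> * B)" if "v \<in> {s..t}" for v
  proof -
    have "c * X v \<omega> \<le> \<bar>c\<bar> * \<bar>X v \<omega>\<bar>"
      by (metis abs_ge_self abs_mult)
    also have "\<dots> \<le> \<bar>c\<bar> * B"
      using B that assms(2) by (intro mult_left_mono) auto
    finally show ?thesis using that assms(2) by simp
  qed
  then show ?thesis
    unfolding set_integrable_def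
    by (intro integrableI_bounded_set_indicator[where B="exp (\<bar>c\<bar> * B)"])
       (auto simp: emeasure_lborel_Icc_eq)
qed

text \<open>The clamped integrand is the one that is measurable on the whole line; on
  \<open>{s..t}\<close> clamping changes nothing.\<close>

lemma exp_functional_eq:
  assumes "0 \<le> s"
  shows "exp_functional X s t \<omega> = (LBINT v:{s..t}. exp (- X (max 0 v) \<omega>))"
  unfolding exp_functional_def using assms by (intro set_lebesgue_integral_cong) auto

lemma measurable_exp_functional [measurable (raw)]:
  assumes [measurable]: "f \<in> borel_measurable N" "g \<in> measurable N M"
  shows "(\<lambda>x. exp_functional X (max 0 (f x)) t (g x)) \<in> borel_measurable N"
proof -
  \<comment> \<open>Moving the variable interval into the integrand leaves a parametrised integral
    of a jointly measurable function.\<close>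
  have "exp_functional X (max 0 (f x)) t (g x)
      = (\<integral>v. (if max 0 (f x) \<le> v \<and> v \<le> t then exp (- X (max 0 v) (g x)) else 0) \<partial>lborel)" for x
    unfolding exp_functional_eq[OF max.cobounded1] set_lebesgue_integral_def
    by (intro Bochner_Integration.integral_cong) (auto split: split_indicator)
  then show ?thesis by simp
qed

lemma random_variable_exp_functional:
  assumes "0 \<le> s"
  shows "random_variable borel (exp_functional X s t)"
  using measurable_exp_functional[of "\<lambda>_. s" M "\<lambda>\<omega>. \<omega>" t] assms by (simp add: max_absorb2)

lemma exp_functional_nonneg: "0 \<le> exp_functional X s t \<omega>"
  unfolding exp_functional_def set_lebesgue_integral_def
  by (intro integral_nonneg_AE AE_I2) simp

lemma exp_functional_pos:
  assumes "\<omega> \<in> space M" "0 \<le> s" "s < t"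
  shows "0 < exp_functional X s t \<omega>"
proof -
  let ?f = "\<lambda>v. exp (- X (max 0 v) \<omega>)"
  have "0 < (\<integral>\<^sup>+v\<in>{s..<t}. ennreal (?f v) \<partial>lborel)"
    using measurable_path[OF assms(1)] \<open>s < t\<close> by (intro set_nn_integral_pos) auto
  also have "\<dots> \<le> (\<integral>\<^sup>+v\<in>{s..t}. ennreal (?f v) \<partial>lborel)"
    by (intro nn_integral_mono) (auto split: split_indicator)
  also have "\<dots> = ennreal (exp_functional X s t \<omega>)"
    unfolding exp_functional_eq[OF \<open>0 \<le> s\<close>]
    using set_integrable_exp_path[OF assms(1,2), of t "-1"]
    by (intro set_nn_integral_eq_set_integral) auto
  finally show ?thesis by (simp add: ennreal_less_zero_iff)
qed

section \<open>Independence of \<open>X u\<close> and the rescaled functional after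
  \<open>u\<close>\<close>

text \<open>On the grid 0, \<open>u\<close>, \<open>u + h n\<close>, ..., \<open>t\<close> the first
  increment is \<open>X u - X 0\<close>, and the Riemann sum depends only on the later ones, whose
  partial sums telescope to the increments from \<open>u\<close>. The assumption
  \<open>0 < u\<close> makes the grid strictly increasing.\<close>

lemma indep_increment_riemann_sum:
  fixes t u :: real and h :: "nat \<Rightarrow> real"
  assumes "0 < u" "u < t"
  defines "h \<equiv> \<lambda>n::nat. (t - u) / real (Suc n)"
  shows "indep_var borel (\<lambda>\<omega>. X u \<omega> - X 0 \<omega>)
    borel (\<lambda>\<omega>. \<Sum>i<Suc n. h n * exp (- (X (u + Suc i * h n) \<omega> - X u \<omega>)))"
proof -
  \<comment> \<open>The shift \<open>i - 1\<close> makes room for the extra first cell from 0 to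
    \<open>u\<close>: \<open>\<tau> 1 = u\<close> and \<open>\<tau> (n + 2) = t\<close>.\<close>
  define \<tau> where "\<tau> i = (if i = 0 then 0 else u + real (i - 1) * h n)" for i :: nat
  define D where "D i \<omega> = X (\<tau> (Suc i)) \<omega> - X (\<tau> i) \<omega>" for i \<omega>
  have h: "0 < h n" using assms by simp
  have "strict_mono_on {..Suc (Suc n)} \<tau>"
  proof (rule strict_mono_onI)
    fix i j :: nat assume "i < j"
    then show "\<tau> i < \<tau> j"
      using h \<open>0 < u\<close> by (auto simp: \<tau>_def intro!: mult_strict_right_mono add_pos_nonneg)
  qed
  moreover have "0 \<le> \<tau> 0" by (simp add: \<tau>_def)
  ultimately have "indep_vars (\<lambda>_. borel) D {..<Suc (Suc n)}"
    unfolding D_def by (intro independent_increments)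
  then have "indep_var (Pi\<^sub>M {0} (\<lambda>_. borel)) (\<lambda>\<omega>. restrict (\<lambda>i. D i \<omega>) {0})
      (Pi\<^sub>M {1..<Suc (Suc n)} (\<lambda>_. borel)) (\<lambda>\<omega>. restrict (\<lambda>i. D i \<omega>) {1..<Suc (Suc n)})"
    by (rule indep_var_restrict) auto
  \<comment> \<open>Each block of increments is mapped to one variable; \<open>d (Suc j)\<close> is
    the increment over the \<open>j\<close>-th cell after \<open>u\<close>.\<close>
  then have "indep_var borel ((\<lambda>d. d 0) \<circ> (\<lambda>\<omega>. restrict (\<lambda>i. D i \<omega>) {0}))
      borel ((\<lambda>d. \<Sum>i<Suc n. h n * exp (- (\<Sum>j<Suc i. d (Suc j)))) \<circ>
        (\<lambda>\<omega>. restrict (\<lambda>i. D i \<omega>) {1..<Suc (Suc n)}))"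
    by (rule indep_var_compose)
       (auto intro!: borel_measurable_sum borel_measurable_times borel_measurable_exp
          borel_measurable_uminus measurable_component_singleton simp del: sum.lessThan_Suc)
  moreover have "(\<lambda>d. d 0) \<circ> (\<lambda>\<omega>. restrict (\<lambda>i. D i \<omega>) {0}) = (\<lambda>\<omega>. X u \<omega> - X 0 \<omega>)"
    by (simp add: fun_eq_iff D_def \<tau>_def)
  moreover have "(\<lambda>d. \<Sum>i<Suc n. h n * exp (- (\<Sum>j<Suc i. d (Suc j)))) \<circ>
        (\<lambda>\<omega>. restrict (\<lambda>i. D i \<omega>) {1..<Suc (Suc n)})
      = (\<lambda>\<omega>. \<Sum>i<Suc n. h n * exp (- (X (u + Suc i * h n) \<omega> - X u \<omega>)))"
  proof (rule ext, unfold comp_def, intro sum.cong refl)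
    fix \<omega> i assume i: "i \<in> {..<Suc n}"
    have "(\<Sum>j<Suc i. restrict (\<lambda>i. D i \<omega>) {1..<Suc (Suc n)} (Suc j))
        = (\<Sum>j<Suc i. X (u + Suc j * h n) \<omega> - X (u + real j * h n) \<omega>)"
      using i by (intro sum.cong) (auto simp: D_def \<tau>_def)
    also have "\<dots> = X (u + Suc i * h n) \<omega> - X u \<omega>"
      by (subst sum_lessThan_telescope) simp
    finally show "h n * exp (- (\<Sum>j<Suc i. restrict (\<lambda>i. D i \<omega>) {1..<Suc (Suc n)} (Suc j)))
        = h n * exp (- (X (u + Suc i * h n) \<omega> - X u \<omega>))"
      by simp
  qed
  ultimately show ?thesis by simp
qed

lemma AE_increment_from_0: "AE \<omega> in M. X u \<omega> - X 0 \<omega> = X u \<omega>"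
  using starts_at_zero by eventually_elim simp

text \<open>The factor \<open>exp (X u \<omega>)\<close> turns each
  \<open>exp (- X v \<omega>)\<close> into the exponential of minus the increment from
  \<open>u\<close> to \<open>v\<close>, which is the integrand sampled by the sums.\<close>

lemma riemann_sum_tendsto_exp_functional:
  assumes "0 \<le> u" "u < t" "\<omega> \<in> space M"
  shows "(\<lambda>n. \<Sum>i<Suc n. (t - u) / Suc n * exp (- (X (u + Suc i * ((t - u) / Suc n)) \<omega> - X u \<omega>)))
    \<longlonglongrightarrow> exp (X u \<omega>) * exp_functional X u t \<omega>"
proof -
  let ?f = "\<lambda>v. exp (- X (max 0 v) \<omega>)"
  obtain B where B: "\<And>v. 0 \<le> v \<Longrightarrow> v \<le> t \<Longrightarrow> \<bar>X v \<omega>\<bar> \<le> B"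
    using path_bounded[OF assms(3), where t=t] by blast
  have "(\<lambda>n. \<Sum>i<Suc n. (t - u) / Suc n * ?f (u + Suc i * ((t - u) / Suc n)))
      \<longlonglongrightarrow> (LBINT v:{u..t}. ?f v)"
  proof (rule right_continuous_imp_riemann_sums[OF \<open>u < t\<close>, where B="exp B"])
    show "?f \<in> borel_measurable borel"
      using measurable_path[OF assms(3)] by measurable
    show "\<bar>?f v\<bar> \<le> exp B" if "v \<in> {u..t}" for v
      using B[of v] that \<open>0 \<le> u\<close> by auto
    show "(?f \<longlongrightarrow> ?f v) (at_right v)" if v: "v \<in> {u..<t}" for v
    proof -
      have "((\<lambda>v. X v \<omega>) \<longlongrightarrow> X v \<omega>) (at_right v)"
        using cadlag_paths[OF assms(3)] v \<open>0 \<le> u\<close> by (simp add: cadlag_def)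
      moreover have "\<forall>\<^sub>F w in at_right v. X w \<omega> = X (max 0 w) \<omega>"
        using v \<open>0 \<le> u\<close> by (intro eventually_at_rightI[of _ "v + 1"]) (auto simp: max_absorb2)
      ultimately have "((\<lambda>w. X (max 0 w) \<omega>) \<longlongrightarrow> X v \<omega>) (at_right v)"
        by (rule Lim_transform_eventually)
      then show ?thesis
        using v \<open>0 \<le> u\<close> by (auto intro!: tendsto_exp tendsto_minus simp: max_absorb2)
    qed
  qed
  from tendsto_mult_left[OF this, of "exp (X u \<omega>)"]
  have "(\<lambda>n. exp (X u \<omega>) * (\<Sum>i<Suc n. (t - u) / Suc n * ?f (u + Suc i * ((t - u) / Suc n))))
      \<longlonglongrightarrow> exp (X u \<omega>) * exp_functional X u t \<omega>"
    by (simp only: exp_functional_eq[OF \<open>0 \<le> u\<close>])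
  moreover have "0 \<le> u + Suc i * ((t - u) / Suc n)" for i n
    using assms by (intro add_nonneg_nonneg mult_nonneg_nonneg) auto
  ultimately show ?thesis
    by (simp add: sum_distrib_left max_absorb2 exp_diff exp_minus field_simps del: sum.lessThan_Suc of_nat_Suc)
qed

text \<open>Truncation makes dominated convergence applicable to the Riemann sums.\<close>

lemma nn_integral_exp_mult_exp_functional:
  fixes u t q \<beta> :: real
  assumes "0 < u" "u < t" "0 \<le> \<beta>" and int: "integrable M (\<lambda>\<omega>. exp (- q * X u \<omega>))"
  defines "J \<equiv> \<lambda>\<omega>. exp (X u \<omega>) * exp_functional X u t \<omega>"
  shows "(\<integral>\<^sup>+\<omega>. ennreal (exp (- q * X u \<omega>)) * ennreal (J \<omega> powr \<beta>) \<partial>M)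
    = (\<integral>\<^sup>+\<omega>. ennreal (exp (- q * X u \<omega>)) \<partial>M) * (\<integral>\<^sup>+\<omega>. ennreal (J \<omega> powr \<beta>) \<partial>M)"
proof -
  define R where "R n \<omega> = (\<Sum>i<Suc n. (t - u) / Suc n * exp (- (X (u + Suc i * ((t - u) / Suc n)) \<omega> - X u \<omega>)))"
    for n \<omega>
  let ?E = "\<lambda>\<omega>. ennreal (exp (- q * X u \<omega>))"
  have [measurable]: "random_variable borel (X u)"
    using \<open>0 < u\<close> by (intro random_variable_process) simp
  have [measurable]: "random_variable borel (exp_functional X u t)"
    using \<open>0 < u\<close> by (intro random_variable_exp_functional) simp
  have J [measurable]: "random_variable borel J"
    unfolding J_def by measurable
  have J_pos: "0 < J \<omega>" if "\<omega> \<in> space M" for \<omega>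
    unfolding J_def using exp_functional_pos[OF that, of u t] assms by simp
  have J_nonneg: "0 \<le> J \<omega>" for \<omega>
    unfolding J_def by (simp add: exp_functional_nonneg)
  have indep: "indep_var borel (\<lambda>\<omega>. X u \<omega> - X 0 \<omega>) borel (R n)" for n
    unfolding R_def by (rule indep_increment_riemann_sum[OF assms(1,2)])
  have [measurable]: "random_variable borel (R n)" for n
    using indep_var_rv2[OF indep] .
  have R_lim: "(\<lambda>n. R n \<omega>) \<longlonglongrightarrow> J \<omega>" if "\<omega> \<in> space M" for \<omega>
    unfolding R_def J_def using assms that by (intro riemann_sum_tendsto_exp_functional) auto
  have R_nonneg: "0 \<le> R n \<omega>" for n \<omega>
    unfolding R_def using assms by (intro sum_nonneg) auto
  \<comment> \<open>The cutoff \<open>real N + 1\<close> is positive even for \<open>N = 0\<close>,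
    so the limiting base \<open>min (J \<omega>) (real N + 1)\<close> is positive and
    \<open>powr\<close> is continuous there.\<close>
  define T where "T N x = ennreal ((min x (real N + 1)) powr \<beta>)" for N :: nat and x :: real
  have [measurable]: "T N \<in> borel_measurable borel" for N
    unfolding T_def by measurable
  have T_le: "T N x \<le> ennreal ((real N + 1) powr \<beta>)" if "0 \<le> x" for N x
    unfolding T_def using that \<open>0 \<le> \<beta>\<close> by (intro ennreal_leI powr_mono2) auto
  have T_lim: "(\<lambda>n. T N (R n \<omega>)) \<longlonglongrightarrow> T N (J \<omega>)" if "\<omega> \<in> space M" for N \<omega>
    unfolding T_def using J_pos[OF that] R_lim[OF that]
    by (intro tendsto_ennrealI tendsto_powr tendsto_min tendsto_const) auto
  have E_fin: "(\<integral>\<^sup>+\<omega>. ?E \<omega> \<partial>M) < \<infinity>"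
    using int by (subst nn_integral_eq_integral) auto
  \<comment> \<open>Independence is available for \<open>X u - X 0\<close>; it passes to
    \<open>X u\<close> because \<open>X 0\<close> vanishes almost surely.\<close>
  have R_prod: "(\<integral>\<^sup>+\<omega>. ?E \<omega> * T N (R n \<omega>) \<partial>M) = (\<integral>\<^sup>+\<omega>. ?E \<omega> \<partial>M) * (\<integral>\<^sup>+\<omega>. T N (R n \<omega>) \<partial>M)" for N n
  proof -
    have "(\<integral>\<^sup>+\<omega>. ennreal (exp (- q * (X u \<omega> - X 0 \<omega>))) * T N (R n \<omega>) \<partial>M)
        = (\<integral>\<^sup>+\<omega>. ennreal (exp (- q * (X u \<omega> - X 0 \<omega>))) \<partial>M) * (\<integral>\<^sup>+\<omega>. T N (R n \<omega>) \<partial>M)"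
      by (rule nn_integral_indep_mult[OF indep, of "\<lambda>x. ennreal (exp (- q * x))"]) measurable
    moreover have "(\<integral>\<^sup>+\<omega>. ennreal (exp (- q * (X u \<omega> - X 0 \<omega>))) * T N (R n \<omega>) \<partial>M)
        = (\<integral>\<^sup>+\<omega>. ?E \<omega> * T N (R n \<omega>) \<partial>M)"
      using AE_increment_from_0[of u] by (intro nn_integral_cong_AE) (auto elim: eventually_mono)
    moreover have "(\<integral>\<^sup>+\<omega>. ennreal (exp (- q * (X u \<omega> - X 0 \<omega>))) \<partial>M) = (\<integral>\<^sup>+\<omega>. ?E \<omega> \<partial>M)"
      using AE_increment_from_0[of u] by (intro nn_integral_cong_AE) (auto elim: eventually_mono)
    ultimately show ?thesis by simp
  qed
  \<comment> \<open>The mesh is refined first, with \<open>N\<close> fixed: truncation dominates the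
    integrands by a multiple of the integrable \<open>exp (- q * X u \<omega>)\<close>.\<close>
  have J_prod: "(\<integral>\<^sup>+\<omega>. ?E \<omega> * T N (J \<omega>) \<partial>M) = (\<integral>\<^sup>+\<omega>. ?E \<omega> \<partial>M) * (\<integral>\<^sup>+\<omega>. T N (J \<omega>) \<partial>M)" for N
  proof (rule LIMSEQ_unique)
    show "(\<lambda>n. \<integral>\<^sup>+\<omega>. ?E \<omega> * T N (R n \<omega>) \<partial>M) \<longlonglongrightarrow> (\<integral>\<^sup>+\<omega>. ?E \<omega> * T N (J \<omega>) \<partial>M)"
    proof (rule nn_integral_dominated_convergence[where w="\<lambda>\<omega>. ?E \<omega> * ennreal ((real N + 1) powr \<beta>)"])
      show "(\<integral>\<^sup>+\<omega>. ?E \<omega> * ennreal ((real N + 1) powr \<beta>) \<partial>M) < \<infinity>"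
        using E_fin by (subst nn_integral_multc) (auto simp: ennreal_mult_less_top)
      show "AE \<omega> in M. (\<lambda>n. ?E \<omega> * T N (R n \<omega>)) \<longlonglongrightarrow> ?E \<omega> * T N (J \<omega>)"
        by (intro AE_I2 ennreal_tendsto_cmult T_lim) auto
    qed (auto intro!: mult_left_mono T_le R_nonneg)
    have "(\<lambda>n. \<integral>\<^sup>+\<omega>. T N (R n \<omega>) \<partial>M) \<longlonglongrightarrow> (\<integral>\<^sup>+\<omega>. T N (J \<omega>) \<partial>M)"
      by (rule nn_integral_dominated_convergence[where w="\<lambda>\<omega>. ennreal ((real N + 1) powr \<beta>)"])
         (auto intro!: T_le R_nonneg T_lim simp: emeasure_space_1)
    then show "(\<lambda>n. \<integral>\<^sup>+\<omega>. ?E \<omega> * T N (R n \<omega>) \<partial>M) \<longlonglongrightarrow> (\<integral>\<^sup>+\<omega>. ?E \<omega> \<partial>M) * (\<integral>\<^sup>+\<omega>. T N (J \<omega>) \<partial>M)"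
      unfolding R_prod using E_fin by (intro ennreal_tendsto_cmult) auto
  qed
  have T_mono: "T N x \<le> T N' x" if "N \<le> N'" "0 \<le> x" for N N' x
    unfolding T_def using that \<open>0 \<le> \<beta>\<close> by (intro ennreal_leI powr_mono2) auto
  have T_SUP: "(\<lambda>N. T N x) \<longlonglongrightarrow> ennreal (x powr \<beta>)" for x
  proof (rule tendsto_eventually)
    obtain N0 where "x \<le> real N0" using real_arch_simple by blast
    then show "\<forall>\<^sub>F N in sequentially. T N x = ennreal (x powr \<beta>)"
      unfolding T_def by (intro eventually_sequentiallyI[of N0]) (simp add: min_absorb1)
  qed
  \<comment> \<open>The truncation is then lifted by monotone convergence. The moment of
    \<open>J\<close> may be infinite; passing the limit through the product uses only that the other
    factor is finite.\<close>
  show ?thesis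
  proof (rule LIMSEQ_unique)
    show "(\<lambda>N. \<integral>\<^sup>+\<omega>. ?E \<omega> * T N (J \<omega>) \<partial>M) \<longlonglongrightarrow> (\<integral>\<^sup>+\<omega>. ?E \<omega> * ennreal (J \<omega> powr \<beta>) \<partial>M)"
      using J_nonneg by (intro nn_integral_LIMSEQ)
        (auto intro!: mult_left_mono T_mono ennreal_tendsto_cmult T_SUP simp: incseq_def le_fun_def less_imp_le)
    have "(\<lambda>N. \<integral>\<^sup>+\<omega>. T N (J \<omega>) \<partial>M) \<longlonglongrightarrow> (\<integral>\<^sup>+\<omega>. ennreal (J \<omega> powr \<beta>) \<partial>M)"
      using J_nonneg by (intro nn_integral_LIMSEQ)
        (auto intro!: T_mono T_SUP simp: incseq_def le_fun_def less_imp_le)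
    then show "(\<lambda>N. \<integral>\<^sup>+\<omega>. ?E \<omega> * T N (J \<omega>) \<partial>M) \<longlonglongrightarrow> (\<integral>\<^sup>+\<omega>. ?E \<omega> \<partial>M) * (\<integral>\<^sup>+\<omega>. ennreal (J \<omega> powr \<beta>) \<partial>M)"
      unfolding J_prod using E_fin by (intro ennreal_tendsto_cmult) auto
  qed
qed

section \<open>Bounds on exponential moments and finiteness of the functional's moments\<close>

lemma nn_integral_set_swap:
  assumes [measurable]: "(\<lambda>p. F (fst p) (snd p)) \<in> borel_measurable (borel \<Otimes>\<^sub>M M)"
  shows "(\<integral>\<^sup>+\<omega>. (\<integral>\<^sup>+v\<in>{s..t::real}. F v \<omega> \<partial>lborel) \<partial>M) = (\<integral>\<^sup>+v\<in>{s..t}. (\<integral>\<^sup>+\<omega>. F v \<omega> \<partial>M) \<partial>lborel)"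
proof -
  interpret pair_sigma_finite lborel M ..
  have [measurable]: "(\<lambda>\<omega>. F v \<omega>) \<in> borel_measurable M" for v
    using measurable_compose[OF measurable_Pair1' assms, of v] by simp
  have "(\<integral>\<^sup>+\<omega>. (\<integral>\<^sup>+v\<in>{s..t}. F v \<omega> \<partial>lborel) \<partial>M) = (\<integral>\<^sup>+v. (\<integral>\<^sup>+\<omega>. F v \<omega> * indicator {s..t} v \<partial>M) \<partial>lborel)"
    by (rule Fubini') (simp add: case_prod_beta')
  also have "\<dots> = (\<integral>\<^sup>+v\<in>{s..t}. (\<integral>\<^sup>+\<omega>. F v \<omega> \<partial>M) \<partial>lborel)"
    by (intro nn_integral_cong nn_integral_multc) simp
  finally show ?thesis .
qed

text \<open>Along a sequence of times violating the claim, the events converge pointwise to the whole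
  space, because each path is bounded.\<close>

lemma increments_bounded_in_probability:
  assumes "0 \<le> t"
  obtains K :: real where "\<And>u. u \<in> {0..t} \<Longrightarrow> 1 / 2 \<le> prob {\<omega> \<in> space M. \<bar>X t \<omega> - X u \<omega>\<bar> \<le> K}"
proof (rule ccontr)
  assume "\<not> thesis"
  with that have "\<exists>u\<in>{0..t}. prob {\<omega> \<in> space M. \<bar>X t \<omega> - X u \<omega>\<bar> \<le> K} < 1 / 2" for K
    by (meson not_le)
  then have "\<forall>n::nat. \<exists>u\<in>{0..t}. prob {\<omega> \<in> space M. \<bar>X t \<omega> - X u \<omega>\<bar> \<le> real n} < 1 / 2"
    by blast
  then obtain u where u: "\<And>n. u n \<in> {0..t}"
    and small: "\<And>n. prob {\<omega> \<in> space M. \<bar>X t \<omega> - X (u n) \<omega>\<bar> \<le> real n} < 1 / 2"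
    by metis
  define A where "A n = {\<omega> \<in> space M. \<bar>X t \<omega> - X (u n) \<omega>\<bar> \<le> real n}" for n
  have [measurable]: "random_variable borel (X t)" "\<And>n. random_variable borel (X (u n))"
    using u assms by (auto intro!: random_variable_process)
  have [measurable]: "A n \<in> sets M" for n
    unfolding A_def by measurable
  have lim: "(\<lambda>n. indicator (A n) \<omega> :: real) \<longlonglongrightarrow> 1" if \<omega>: "\<omega> \<in> space M" for \<omega>
  proof (rule tendsto_eventually)
    obtain B where B: "\<And>v. 0 \<le> v \<Longrightarrow> v \<le> t \<Longrightarrow> \<bar>X v \<omega>\<bar> \<le> B"
      using path_bounded[OF \<omega>, where t=t] by blast
    obtain N where N: "2 * B \<le> real N" using real_arch_simple by blast
    have "\<omega> \<in> A n" if "N \<le> n" for n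
      using B[of t] B[of "u n"] u[of n] N that \<omega> assms by (auto simp: A_def)
    then show "\<forall>\<^sub>F n in sequentially. indicator (A n) \<omega> = (1::real)"
      by (intro eventually_sequentiallyI[of N]) simp
  qed
  have "(\<lambda>n. \<integral>\<omega>. indicator (A n) \<omega> \<partial>M) \<longlonglongrightarrow> (\<integral>\<omega>. 1 \<partial>M :: real)"
    by (rule integral_dominated_convergence[where w="\<lambda>_. 1"])
       (use lim in \<open>auto simp: indicator_def\<close>)
  then have "(\<lambda>n. prob (A n)) \<longlonglongrightarrow> 1"
    by (simp add: prob_space)
  then have "1 \<le> (1 / 2 :: real)"
    by (rule LIMSEQ_le_const2) (use small in \<open>auto simp: A_def intro: less_imp_le\<close>)
  then show False by simp
qed

text \<open>The independence of the two increments is read off from the Riemann sum with one cell,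
  whose only term is \<open>(t - u) * exp (- (X t \<omega> - X u \<omega>))\<close>.\<close>

lemma nn_integral_exp_increment:
  fixes t u :: real
  assumes "0 < u" "u < t"
  shows "(\<integral>\<^sup>+\<omega>. ennreal (exp (- q * X t \<omega>)) \<partial>M)
    = (\<integral>\<^sup>+\<omega>. ennreal (exp (- q * X u \<omega>)) \<partial>M) * (\<integral>\<^sup>+\<omega>. ennreal (exp (- q * (X t \<omega> - X u \<omega>))) \<partial>M)"
proof -
  \<comment> \<open>\<open>?g\<close> removes the mesh factor \<open>t - u\<close> and raises the
    remaining exponential to the power \<open>q\<close>.\<close>
  let ?f = "\<lambda>x::real. ennreal (exp (- q * x))" and ?g = "\<lambda>x. ennreal ((x / (t - u)) powr q)"
  have "indep_var borel (\<lambda>\<omega>. X u \<omega> - X 0 \<omega>) borel (\<lambda>\<omega>. (t - u) * exp (- (X t \<omega> - X u \<omega>)))"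
    using indep_increment_riemann_sum[OF assms, of 0] by simp
  then have "(\<integral>\<^sup>+\<omega>. ?f (X u \<omega> - X 0 \<omega>) * ?g ((t - u) * exp (- (X t \<omega> - X u \<omega>))) \<partial>M)
      = (\<integral>\<^sup>+\<omega>. ?f (X u \<omega> - X 0 \<omega>) \<partial>M) * (\<integral>\<^sup>+\<omega>. ?g ((t - u) * exp (- (X t \<omega> - X u \<omega>))) \<partial>M)"
    by (rule nn_integral_indep_mult) measurable
  moreover have "?g ((t - u) * exp (- (X t \<omega> - X u \<omega>))) = ?f (X t \<omega> - X u \<omega>)" for \<omega>
    using assms by (simp add: powr_def right_diff_distrib)
  ultimately have "(\<integral>\<^sup>+\<omega>. ?f (X u \<omega> - X 0 \<omega>) * ?f (X t \<omega> - X u \<omega>) \<partial>M)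
      = (\<integral>\<^sup>+\<omega>. ?f (X u \<omega> - X 0 \<omega>) \<partial>M) * (\<integral>\<^sup>+\<omega>. ?f (X t \<omega> - X u \<omega>) \<partial>M)"
    by (simp only:)
  moreover have "(\<integral>\<^sup>+\<omega>. ?f (X u \<omega> - X 0 \<omega>) * ?f (X t \<omega> - X u \<omega>) \<partial>M) = (\<integral>\<^sup>+\<omega>. ?f (X t \<omega>) \<partial>M)"
    using AE_increment_from_0[of u]
    by (intro nn_integral_cong_AE, eventually_elim)
       (simp add: ennreal_mult[symmetric] exp_add[symmetric] algebra_simps)
  moreover have "(\<integral>\<^sup>+\<omega>. ?f (X u \<omega> - X 0 \<omega>) \<partial>M) = (\<integral>\<^sup>+\<omega>. ?f (X u \<omega>) \<partial>M)"
    using AE_increment_from_0[of u] by (intro nn_integral_cong_AE) (auto elim: eventually_mono)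
  ultimately show ?thesis by simp
qed

text \<open>The moment at \<open>t\<close> is the moment at \<open>u\<close> times that of the
  increment. With probability at least 1/2 the increment is at most \<open>K\<close>, so its factor
  is at least \<open>exp (- q * K) / 2\<close>, uniformly in \<open>u\<close>, and the moment at
  \<open>t\<close> controls all earlier ones.\<close>

lemma exponential_moment_bounded:
  assumes "0 \<le> t" "0 \<le> q" and int: "integrable M (\<lambda>\<omega>. exp (- q * X t \<omega>))"
  obtains C :: real where "0 \<le> C"
    "\<And>u. 0 < u \<Longrightarrow> u < t \<Longrightarrow> (\<integral>\<^sup>+\<omega>. ennreal (exp (- q * X u \<omega>)) \<partial>M) \<le> ennreal C"
proof -
  obtain K where K: "\<And>u. u \<in> {0..t} \<Longrightarrow> 1 / 2 \<le> prob {\<omega> \<in> space M. \<bar>X t \<omega> - X u \<omega>\<bar> \<le> K}"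
    using increments_bounded_in_probability[OF \<open>0 \<le> t\<close>] by blast
  let ?A = "\<lambda>u. \<integral>\<^sup>+\<omega>. ennreal (exp (- q * X u \<omega>)) \<partial>M"
  define E where "E = (\<integral>\<omega>. exp (- q * X t \<omega>) \<partial>M)"
  have E: "?A t = ennreal E" "0 \<le> E"
    unfolding E_def using int by (auto intro!: nn_integral_eq_integral)
  have "?A u \<le> ennreal (E * (2 * exp (q * K)))" if u: "0 < u" "u < t" for u
  proof -
    have [measurable]: "random_variable borel (X t)" "random_variable borel (X u)"
      using u by (auto intro!: random_variable_process)
    let ?S = "{\<omega> \<in> space M. \<bar>X t \<omega> - X u \<omega>\<bar> \<le> K}"
    have "ennreal (exp (- q * K) / 2) \<le> ennreal (exp (- q * K)) * ennreal (prob ?S)"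
      using K[of u] u by (simp add: ennreal_mult[symmetric] ennreal_leI)
    also have "\<dots> = (\<integral>\<^sup>+\<omega>. ennreal (exp (- q * K)) * indicator ?S \<omega> \<partial>M)"
      by (subst nn_integral_cmult_indicator) (auto simp: emeasure_eq_measure)
    also have "\<dots> \<le> (\<integral>\<^sup>+\<omega>. ennreal (exp (- q * (X t \<omega> - X u \<omega>))) \<partial>M)"
      using \<open>0 \<le> q\<close> by (intro nn_integral_mono)
        (auto intro!: ennreal_leI mult_left_mono split: split_indicator)
    finally have "?A u * ennreal (exp (- q * K) / 2) \<le> ennreal E"
      unfolding E(1)[symmetric] nn_integral_exp_increment[OF u] by (rule mult_left_mono) simp
    \<comment> \<open>Multiplying by the inverse constant replaces division in the extended
      reals.\<close>
    then have "?A u * ennreal (exp (- q * K) / 2) * ennreal (2 * exp (q * K)) \<le> ennreal E * ennreal (2 * exp (q * K))"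
      by (rule mult_right_mono) simp
    moreover have "ennreal (exp (- q * K) / 2) * ennreal (2 * exp (q * K)) = 1"
      by (subst ennreal_mult[symmetric]) (auto simp: exp_add[symmetric])
    ultimately show ?thesis
      using E(2) by (simp add: mult.assoc ennreal_mult)
  qed
  then show thesis using that[of "E * (2 * exp (q * K))"] E(2) by simp
qed

text \<open>Jensen's inequality along each path and Tonelli reduce the claim to the uniform bound on
  the exponential moments. The case \<open>s = t\<close> is separate because the uniform
  distribution needs an interval of positive length.\<close>

lemma exp_functional_moment_finite:
  fixes s t \<alpha> :: real
  assumes int: "integrable M (\<lambda>\<omega>. exp (- \<alpha> * X t \<omega>))" and "1 \<le> \<alpha>" "0 \<le> s" "s \<le> t"
  shows "exp_functional_moment M X \<alpha> s t < \<infinity>"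
proof (cases "s = t")
  case True
  have "exp_functional X t t \<omega> = 0" for \<omega>
    unfolding exp_functional_def set_lebesgue_integral_def
    by (rule integral_eq_zero_AE) (use AE_lborel_singleton[of t] in \<open>auto elim: eventually_mono\<close>)
  then show ?thesis
    using True \<open>1 \<le> \<alpha>\<close> by (simp add: exp_functional_moment_def)
next
  case False
  then have "s < t" using \<open>s \<le> t\<close> by simp
  let ?c = "(t - s) powr (\<alpha> - 1)"
  have "0 \<le> t" "0 \<le> \<alpha>" using assms by auto
  then obtain C where C: "0 \<le> C"
    "\<And>u. 0 < u \<Longrightarrow> u < t \<Longrightarrow> (\<integral>\<^sup>+\<omega>. ennreal (exp (- \<alpha> * X u \<omega>)) \<partial>M) \<le> ennreal C"
    using exponential_moment_bounded[OF _ _ int] by blast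
  have jensen: "ennreal (exp_functional X s t \<omega> powr \<alpha>)
      \<le> ennreal ?c * (\<integral>\<^sup>+v\<in>{s..t}. ennreal (exp (- \<alpha> * X (max 0 v) \<omega>)) \<partial>lborel)"
    if \<omega>: "\<omega> \<in> space M" for \<omega>
  proof -
    let ?f = "\<lambda>v. exp (- X (max 0 v) \<omega>)"
    note int1 = set_integrable_exp_path[OF \<omega> \<open>0 \<le> s\<close>, of t "-1", simplified]
    note int\<alpha> = set_integrable_exp_path[OF \<omega> \<open>0 \<le> s\<close>, of t "-\<alpha>"]
    have powr: "?f v powr \<alpha> = exp (- \<alpha> * X (max 0 v) \<omega>)" for v
      by (simp add: powr_def)
    have "(LBINT v:{s..t}. ?f v) powr \<alpha> \<le> ?c * (LBINT v:{s..t}. ?f v powr \<alpha>)"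
    proof (rule set_integral_powr_le)
      show "?f \<in> borel_measurable borel"
        using measurable_path[OF \<omega>] by measurable
    qed (use int1 int\<alpha> powr \<open>s < t\<close> \<open>1 \<le> \<alpha>\<close> in simp_all)
    moreover have "(\<integral>\<^sup>+v\<in>{s..t}. ennreal (exp (- \<alpha> * X (max 0 v) \<omega>)) \<partial>lborel)
        = ennreal (LBINT v:{s..t}. exp (- \<alpha> * X (max 0 v) \<omega>))"
      using int\<alpha> by (intro set_nn_integral_eq_set_integral) auto
    ultimately show ?thesis
      by (simp add: powr exp_functional_eq[OF \<open>0 \<le> s\<close>] ennreal_mult'[symmetric] ennreal_leI)
  qed
  have "exp_functional_moment M X \<alpha> s t = (\<integral>\<^sup>+\<omega>. ennreal (exp_functional X s t \<omega> powr \<alpha>) \<partial>M)"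
    using \<open>1 \<le> \<alpha>\<close> by (simp add: exp_functional_moment_def)
  also have "\<dots> \<le> (\<integral>\<^sup>+\<omega>. ennreal ?c * (\<integral>\<^sup>+v\<in>{s..t}. ennreal (exp (- \<alpha> * X (max 0 v) \<omega>)) \<partial>lborel) \<partial>M)"
    by (intro nn_integral_mono jensen)
  also have "\<dots> = ennreal ?c * (\<integral>\<^sup>+\<omega>. (\<integral>\<^sup>+v\<in>{s..t}. ennreal (exp (- \<alpha> * X (max 0 v) \<omega>)) \<partial>lborel) \<partial>M)"
    by (rule nn_integral_cmult) measurable
  also have "\<dots> = ennreal ?c * (\<integral>\<^sup>+v\<in>{s..t}. (\<integral>\<^sup>+\<omega>. ennreal (exp (- \<alpha> * X (max 0 v) \<omega>)) \<partial>M) \<partial>lborel)"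
    by (subst nn_integral_set_swap) auto
  also have "(\<integral>\<^sup>+v\<in>{s..t}. (\<integral>\<^sup>+\<omega>. ennreal (exp (- \<alpha> * X (max 0 v) \<omega>)) \<partial>M) \<partial>lborel)
      \<le> (\<integral>\<^sup>+v\<in>{s..t}. ennreal C \<partial>lborel)"
    \<comment> \<open>The bound \<open>C\<close> is known for \<open>0 < v < t\<close> only; the two
      endpoints are null.\<close>
    using AE_lborel_singleton[of 0] AE_lborel_singleton[of t]
    by (intro nn_integral_mono_AE, eventually_elim)
       (use C(2) \<open>0 \<le> s\<close> in \<open>auto simp: max_absorb2 split: split_indicator\<close>)
  also have "(\<integral>\<^sup>+v\<in>{s..t}. ennreal C \<partial>lborel) = ennreal (C * (t - s))"
    using \<open>s < t\<close> C(1) by (subst nn_integral_cmult_indicator) (auto simp: ennreal_mult)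
  finally show ?thesis
    by (rule order_le_less_trans) (auto simp: ennreal_mult_less_top mult_left_mono)
qed

section \<open>Change of exponent and the moment recursion\<close>

text \<open>Both expectations factor as a Laplace transform at time \<open>u\<close>, with exponent
  \<open>\<alpha>\<close> or \<open>\<alpha> - 1\<close>, times the same moment of \<open>J\<close>;
  they therefore differ by the quotient of the transforms.\<close>

lemma nn_integral_exp_functional_powr_mult_exp:
  fixes u t \<alpha> :: real
  assumes int: "\<And>q. 0 \<le> q \<Longrightarrow> integrable M (\<lambda>\<omega>. exp (- q * X u \<omega>))"
    and "1 \<le> \<alpha>" "0 < u" "u < t"
  shows "(\<integral>\<^sup>+\<omega>. ennreal (exp_functional X u t \<omega> powr (\<alpha> - 1)) * ennreal (exp (- X u \<omega>)) \<partial>M)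
    = exp_functional_moment M X (\<alpha> - 1) u t *
        ennreal (exp (- (laplace_exponent M X u \<alpha> - laplace_exponent M X u (\<alpha> - 1))))"
proof -
  let ?I = "exp_functional X u t"
  define \<beta> where "\<beta> = \<alpha> - 1"
  define L where "L q = (\<integral>\<omega>. exp (- q * X u \<omega>) \<partial>M)" for q
  define J where "J \<omega> = exp (X u \<omega>) * ?I \<omega>" for \<omega>
  have [measurable]: "random_variable borel (X u)"
    using \<open>0 < u\<close> by (intro random_variable_process) simp
  have "0 \<le> \<alpha>" "0 \<le> \<beta>" "\<alpha> = \<beta> + 1" using \<open>1 \<le> \<alpha>\<close> by (simp_all add: \<beta>_def)
  have I_pos: "0 < ?I \<omega>" if "\<omega> \<in> space M" for \<omega>
    using exp_functional_pos[OF that, of u t] assms by simp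
  \<comment> \<open>Strict positivity permits division by \<open>L \<beta>\<close> and makes
    \<open>exp\<close> undo the logarithms in the Laplace exponents.\<close>
  have L_pos: "0 < L q" if "0 \<le> q" for q
  proof -
    have "L q \<noteq> 0"
      unfolding L_def by (subst integral_nonneg_eq_0_iff_AE[OF int[OF that]]) (auto simp: AE_False)
    then show ?thesis
      using Bochner_Integration.integral_nonneg[of M "\<lambda>\<omega>. exp (- q * X u \<omega>)"] by (simp add: L_def order_less_le)
  qed
  have L: "(\<integral>\<^sup>+\<omega>. ennreal (exp (- q * X u \<omega>)) \<partial>M) = ennreal (L q)" if "0 \<le> q" for q
    unfolding L_def using int[OF that] by (intro nn_integral_eq_integral) auto
  have \<Phi>: "laplace_exponent M X u q = - ln (L q)" for q
    unfolding laplace_exponent_def L_def ..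
  note factor = nn_integral_exp_mult_exp_functional[OF \<open>0 < u\<close> \<open>u < t\<close> \<open>0 \<le> \<beta>\<close> int, folded J_def]
  have I_powr: "?I \<omega> powr \<beta> = exp (- \<beta> * X u \<omega>) * J \<omega> powr \<beta>" for \<omega>
  proof -
    have I_eq: "?I \<omega> = exp (- X u \<omega>) * J \<omega>"
      by (simp add: J_def mult.assoc[symmetric] exp_add[symmetric])
    have "(exp (- X u \<omega>) * J \<omega>) powr \<beta> = exp (- X u \<omega>) powr \<beta> * J \<omega> powr \<beta>"
      by (rule powr_mult)
    also have "exp (- X u \<omega>) powr \<beta> = exp (- \<beta> * X u \<omega>)"
      by (simp add: powr_def)
    finally show ?thesis using I_eq by simp
  qed
  have "exp_functional_moment M X \<beta> u t = (\<integral>\<^sup>+\<omega>. ennreal (exp (- \<beta> * X u \<omega>)) * ennreal (J \<omega> powr \<beta>) \<partial>M)"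
    unfolding exp_functional_moment_def
  proof (intro nn_integral_cong)
    fix \<omega> assume "\<omega> \<in> space M"
    \<comment> \<open>Since \<open>u < t\<close>, the functional is positive, so \<open>powr\<close>
      with exponent 0 already gives 1, in agreement with the convention of the moment.\<close>
    then have "(if \<beta> = 0 then 1 else ?I \<omega> powr \<beta>) = ?I \<omega> powr \<beta>"
      using I_pos by force
    then show "ennreal (if \<beta> = 0 then 1 else ?I \<omega> powr \<beta>) = ennreal (exp (- \<beta> * X u \<omega>)) * ennreal (J \<omega> powr \<beta>)"
      by (simp only: I_powr) (simp add: ennreal_mult)
  qed
  also have "\<dots> = ennreal (L \<beta>) * (\<integral>\<^sup>+\<omega>. ennreal (J \<omega> powr \<beta>) \<partial>M)"
    unfolding factor[OF \<open>0 \<le> \<beta>\<close>] L[OF \<open>0 \<le> \<beta>\<close>] ..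
  finally have moment: "exp_functional_moment M X \<beta> u t = ennreal (L \<beta>) * (\<integral>\<^sup>+\<omega>. ennreal (J \<omega> powr \<beta>) \<partial>M)" .
  have "(\<integral>\<^sup>+\<omega>. ennreal (?I \<omega> powr \<beta>) * ennreal (exp (- X u \<omega>)) \<partial>M)
      = (\<integral>\<^sup>+\<omega>. ennreal (exp (- \<alpha> * X u \<omega>)) * ennreal (J \<omega> powr \<beta>) \<partial>M)"
  proof (intro nn_integral_cong)
    fix \<omega>
    have "exp (- \<alpha> * X u \<omega>) = exp (- \<beta> * X u \<omega>) * exp (- X u \<omega>)"
      by (simp add: \<open>\<alpha> = \<beta> + 1\<close> exp_add[symmetric] algebra_simps)
    then show "ennreal (?I \<omega> powr \<beta>) * ennreal (exp (- X u \<omega>)) = ennreal (exp (- \<alpha> * X u \<omega>)) * ennreal (J \<omega> powr \<beta>)"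
      by (simp add: I_powr ennreal_mult[symmetric] mult_ac)
  qed
  also have "\<dots> = ennreal (L \<alpha>) * (\<integral>\<^sup>+\<omega>. ennreal (J \<omega> powr \<beta>) \<partial>M)"
    unfolding factor[OF \<open>0 \<le> \<alpha>\<close>] L[OF \<open>0 \<le> \<alpha>\<close>] ..
  \<comment> \<open>Only the finite positive number \<open>L \<beta>\<close> is cancelled, never the
    common moment of \<open>J\<close>, which could be infinite here.\<close>
  also have "\<dots> = exp_functional_moment M X \<beta> u t * ennreal (L \<alpha> / L \<beta>)"
  proof -
    have "ennreal (L \<beta>) * ennreal (L \<alpha> / L \<beta>) = ennreal (L \<alpha>)"
      using L_pos[OF \<open>0 \<le> \<beta>\<close>] L_pos[of \<alpha>] \<open>1 \<le> \<alpha>\<close> by (simp add: ennreal_mult[symmetric])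
    then show ?thesis
      unfolding moment by (metis mult.assoc mult.commute)
  qed
  also have "L \<alpha> / L \<beta> = exp (- (laplace_exponent M X u \<alpha> - laplace_exponent M X u \<beta>))"
    using L_pos[OF \<open>0 \<le> \<beta>\<close>] L_pos[of \<alpha>] \<open>1 \<le> \<alpha>\<close>
    by (simp add: \<Phi> exp_diff)
  finally show ?thesis by (simp add: \<beta>_def)
qed

end

theorem theorem2p3:
  fixes M :: "'a measure" and X :: "real \<Rightarrow> 'a \<Rightarrow> real" and \<alpha> s t :: real
  assumes "additive_process M X"
    and "\<And>r q. 0 \<le> r \<Longrightarrow> 0 \<le> q \<Longrightarrow> integrable M (\<lambda>\<omega>. exp (- q * X r \<omega>))"
    and "1 \<le> \<alpha>" and "0 \<le> s" and "s \<le> t"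
  shows "exp_functional_moment M X \<alpha> s t < \<infinity> \<and>
    exp_functional_moment M X \<alpha> s t =
      ennreal \<alpha> *
        (\<integral>\<^sup>+u\<in>{s..t}. (exp_functional_moment M X (\<alpha> - 1) u t *
            ennreal (exp (- (laplace_exponent M X u \<alpha> - laplace_exponent M X u (\<alpha> - 1))))) \<partial>lborel)"
proof
  interpret additive_process M X by fact
  note int = assms(2)
  show "exp_functional_moment M X \<alpha> s t < \<infinity>"
    using assms(3-5) by (intro exp_functional_moment_finite int) auto
  \<comment> \<open>Time is clamped at 0 to obtain joint measurability for the exchange of
    integrals.\<close>
  let ?F = "\<lambda>u \<omega>. ennreal (exp_functional X (max 0 u) t \<omega> powr (\<alpha> - 1)) * ennreal (exp (- X (max 0 u) \<omega>))"
  have path: "ennreal (exp_functional X s t \<omega> powr \<alpha>) = ennreal \<alpha> * (\<integral>\<^sup>+u\<in>{s..t}. ?F u \<omega> \<partial>lborel)"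
    if \<omega>: "\<omega> \<in> space M" for \<omega>
  proof -
    let ?f = "\<lambda>v. exp (- X (max 0 v) \<omega>)"
    have "ennreal (exp_functional X s t \<omega> powr \<alpha>)
        = ennreal \<alpha> * (\<integral>\<^sup>+u\<in>{s..t}. (ennreal ((LBINT v:{u..t}. ?f v) powr (\<alpha> - 1)) * ennreal (?f u)) \<partial>lborel)"
      unfolding exp_functional_eq[OF \<open>0 \<le> s\<close>]
    proof (rule tail_integral_powr)
      show "?f \<in> borel_measurable borel"
        using measurable_path[OF \<omega>] by measurable
      show "set_integrable lborel {s..t} ?f"
        using set_integrable_exp_path[OF \<omega> \<open>0 \<le> s\<close>, of t "-1"] by simp
    qed (use assms(3-5) in auto)
    also have "(\<integral>\<^sup>+u\<in>{s..t}. (ennreal ((LBINT v:{u..t}. ?f v) powr (\<alpha> - 1)) * ennreal (?f u)) \<partial>lborel)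
        = (\<integral>\<^sup>+u\<in>{s..t}. ?F u \<omega> \<partial>lborel)"
      using \<open>0 \<le> s\<close> by (intro nn_integral_cong) (auto simp: exp_functional_eq max_absorb2 split: split_indicator)
    finally show ?thesis .
  qed
  have "exp_functional_moment M X \<alpha> s t = (\<integral>\<^sup>+\<omega>. ennreal \<alpha> * (\<integral>\<^sup>+u\<in>{s..t}. ?F u \<omega> \<partial>lborel) \<partial>M)"
    unfolding exp_functional_moment_def using \<open>1 \<le> \<alpha>\<close> by (intro nn_integral_cong) (simp add: path)
  also have "\<dots> = ennreal \<alpha> * (\<integral>\<^sup>+\<omega>. (\<integral>\<^sup>+u\<in>{s..t}. ?F u \<omega> \<partial>lborel) \<partial>M)"
    by (rule nn_integral_cmult) measurable
  also have "\<dots> = ennreal \<alpha> * (\<integral>\<^sup>+u\<in>{s..t}. (\<integral>\<^sup>+\<omega>. ?F u \<omega> \<partial>M) \<partial>lborel)"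
    by (subst nn_integral_set_swap) auto
  also have "(\<integral>\<^sup>+u\<in>{s..t}. (\<integral>\<^sup>+\<omega>. ?F u \<omega> \<partial>M) \<partial>lborel)
      = (\<integral>\<^sup>+u\<in>{s..t}. (exp_functional_moment M X (\<alpha> - 1) u t *
            ennreal (exp (- (laplace_exponent M X u \<alpha> - laplace_exponent M X u (\<alpha> - 1))))) \<partial>lborel)"
  proof (rule nn_integral_cong_AE)
    show "AE u in lborel. (\<integral>\<^sup>+\<omega>. ?F u \<omega> \<partial>M) * indicator {s..t} u
        = (exp_functional_moment M X (\<alpha> - 1) u t *
            ennreal (exp (- (laplace_exponent M X u \<alpha> - laplace_exponent M X u (\<alpha> - 1))))) * indicator {s..t} u"
      \<comment> \<open>The factorisation requires \<open>0 < u < t\<close>. At \<open>u = t\<close>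
        the integrands can really differ: for \<open>\<alpha> = 1\<close> the left one has
        \<open>0 powr 0 = 0\<close>, while the moment with exponent 0 is 1.\<close>
      using AE_lborel_singleton[of 0] AE_lborel_singleton[of t]
    proof eventually_elim
      case (elim u)
      show ?case
      proof (cases "u \<in> {s..t}")
        case True
        then have "0 < u" "u < t" using elim \<open>0 \<le> s\<close> by auto
        then show ?thesis
          using nn_integral_exp_functional_powr_mult_exp[OF int \<open>1 \<le> \<alpha>\<close>, of u t]
          by (simp add: max_absorb2)
      qed simp
    qed
  qed
  finally show "exp_functional_moment M X \<alpha> s t =
      ennreal \<alpha> *
        (\<integral>\<^sup>+u\<in>{s..t}. (exp_functional_moment M X (\<alpha> - 1) u t *
            ennreal (exp (- (laplace_exponent M X u \<alpha> - laplace_exponent M X u (\<alpha> - 1))))) \<partial>lborel)" .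
qed

end
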